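(* The torus $X = S^1 \times S^1$ (with its usual topology) is not self-Tietze, but it is set-self-Tietze.
   Context: A topological space $X$ is self-Tietze if for every closed $A \subseteq X$ and every continuous function $f : A \to X$ there is a continuous function $F : X \to X$ with $F|_A = f$. For a topological space $Y$, $2^Y$ denotes the collection of non-empty closed subsets of $Y$. A set-valued function $f : Z \to 2^Y$ between topological spaces is upper semi-continuous (usc) if for every closed $C \subseteq Y$ the set $f^{-1}(C) = \{z \in Z : f(z) \cap C \neq \emptyset\}$ is closed in $Z$; equivalently, for every open $U \subseteq Y$ the set $\{z \in Z : f(z) \subseteq U\}$ is open in $Z$. A topological space $X$ is set-self-Tietze if for every closed $A \subseteq X$ and every usc $f : A \to 2^X$ there exists a usc $F : X \to 2^X$ with $F|_A = f$. Closed subsets carry the subspace topology. *)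

theory Defs
  imports "HOL-Analysis.Analysis"
begin

definition self_Tietze :: "'a topology \<Rightarrow> bool" where
  "self_Tietze X \<longleftrightarrow>
     (\<forall>A f. closedin X A \<and> continuous_map (subtopology X A) X f \<longrightarrow>
        (\<exists>F. continuous_map X X F \<and> (\<forall>x\<in>A. F x = f x)))"

definition closed_hyperspace :: "'a topology \<Rightarrow> 'a set set" where
  "closed_hyperspace Y = {C. closedin Y C \<and> C \<noteq> {}}"

text \<open>As with \<^const>\<open>continuous_map\<close>, the values of \<open>f\<close> outside \<open>topspace Z\<close> are irrelevant.\<close>

definition usc_map :: "'a topology \<Rightarrow> 'b topology \<Rightarrow> ('a \<Rightarrow> 'b set) \<Rightarrow> bool" where
  "usc_map Z Y f \<longleftrightarrow>
     f \<in> topspace Z \<rightarrow> closed_hyperspace Y \<and>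
     (\<forall>C. closedin Y C \<longrightarrow> closedin Z {z \<in> topspace Z. f z \<inter> C \<noteq> {}})"

definition set_self_Tietze :: "'a topology \<Rightarrow> bool" where
  "set_self_Tietze X \<longleftrightarrow>
     (\<forall>A f. closedin X A \<and> usc_map (subtopology X A) X f \<longrightarrow>
        (\<exists>F. usc_map X X F \<and> (\<forall>x\<in>A. F x = f x)))"

definition circle :: "complex topology" where
  "circle = top_of_set (sphere 0 1)"

definition torus :: "(complex \<times> complex) topology" where
  "torus = prod_topology circle circle"

end

theory Submission
  imports Defs
begin

text \<open>
  The two halves of the theorem have different sources.

  The torus is not self-Tietze because a circle bounding a small embedded disc can be sent
  homeomorphically onto the first factor of the torus. An extension of this map over the whole torus,
  restricted to the disc and followed by the first projection, would be a retraction of a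
  closed disc onto its boundary, which the no-retraction theorem forbids.

  A set-valued map avoids this obstruction, as it need not choose between several values. In fact
  every compact metric space is set-self-Tietze: given a usc map \<open>f\<close> on a non-empty closed set \<open>A\<close>,
  let \<open>F x\<close> be the union of the values \<open>f a\<close> over all points \<open>a\<close> of \<open>A\<close> nearest to \<open>x\<close>. A point of
  \<open>A\<close> is its own only nearest point, so \<open>F\<close> extends \<open>f\<close>. Upper semi-continuity holds because
  \<open>F x\<close> meets a closed set \<open>C\<close> exactly if \<open>B = {a \<in> A. f a \<inter> C \<noteq> {}}\<close> contains a nearest point, that
  is, if \<open>B\<close> is non-empty and the distance from \<open>x\<close> to \<open>B\<close> does not exceed the distance from \<open>x\<close>
  to \<open>A\<close>. As both distances depend continuously on \<open>x\<close>, this is a closed condition.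
\<close>

text \<open>
  The values of the extension are closed by this lemma. If \<open>y\<close> is in the closure of the union, then
  the sets \<open>{a \<in> P. f a \<inter> cball y r \<noteq> {}}\<close> for \<open>r > 0\<close> are closed in the compact set \<open>P\<close> and
  decrease to a non-empty intersection as \<open>r\<close> shrinks; a point \<open>a\<close> of that intersection has
  \<open>y\<close> in the closure of \<open>f a\<close>.
\<close>

lemma closed_UN_usc_over_compact:
  fixes f :: "'a::metric_space \<Rightarrow> 'b::metric_space set"
  assumes usc: "usc_map (top_of_set A) (top_of_set K) f"
    and P: "compact P" "P \<subseteq> A" and K: "closed K"
  shows "closed (\<Union>a\<in>P. f a)"
proof -
  have val: "closed (f a)" "f a \<subseteq> K" if "a \<in> P" for a
  proof -
    have "closedin (top_of_set K) (f a)"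
      using usc that P by (auto simp: usc_map_def closed_hyperspace_def)
    then show "closed (f a)" "f a \<subseteq> K"
      using K closedin_closed_trans closedin_imp_subset by blast+
  qed
  define T where "T n y = {a \<in> P. f a \<inter> cball y (inverse (real (Suc n))) \<noteq> {}}" for n y
  have T_compact: "compact (T n y)" for n y
  proof -
    let ?C = "K \<inter> cball y (inverse (real (Suc n)))"
    have "closedin (top_of_set K) ?C"
      by (intro closedin_closed_Int) simp
    then have "closedin (top_of_set A) {a \<in> A. f a \<inter> ?C \<noteq> {}}"
      using usc by (simp add: usc_map_def)
    then obtain S where "closed S" and S: "{a \<in> A. f a \<inter> ?C \<noteq> {}} = A \<inter> S"
      by (auto simp: closedin_closed)
    moreover have "T n y = P \<inter> S"
    proof -
      have "T n y = P \<inter> {a \<in> A. f a \<inter> ?C \<noteq> {}}"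
        using val(2) P(2) unfolding T_def by blast
      also have "\<dots> = P \<inter> S"
        unfolding S using P(2) by blast
      finally show ?thesis .
    qed
    ultimately show ?thesis
      using P(1) by (simp add: compact_Int_closed)
  qed
  have "y \<in> (\<Union>a\<in>P. f a)" if y: "y \<in> closure (\<Union>a\<in>P. f a)" for y
  proof -
    have ne: "T n y \<noteq> {}" for n
    proof -
      have "inverse (real (Suc n)) > 0"
        by simp
      then obtain z where "z \<in> (\<Union>a\<in>P. f a)" "dist z y < inverse (real (Suc n))"
        using y unfolding closure_approachable by blast
      then show ?thesis
        by (force simp: T_def dist_commute intro: less_imp_le)
    qed
    have mono: "T n y \<subseteq> T m y" if "m \<le> n" for m n
    proof -
      have "inverse (real (Suc n)) \<le> inverse (real (Suc m))"
        using that by (intro le_imp_inverse_le) auto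
      then have "cball y (inverse (real (Suc n))) \<subseteq> cball y (inverse (real (Suc m)))"
        by (rule subset_cball)
      then show ?thesis
        unfolding T_def by blast
    qed
    have "(\<Inter>n. T n y) \<noteq> {}"
    proof (rule compact_space_imp_nest)
      show "compact_space (top_of_set P)"
        using P(1) by (simp add: compact_space_subtopology)
      show "closedin (top_of_set P) (T n y)" for n
        by (intro closed_subset compact_imp_closed T_compact) (auto simp: T_def)
      show "decseq (\<lambda>n. T n y)"
        using mono by (simp add: decseq_def)
    qed (rule ne)
    then obtain a where a: "\<And>n. a \<in> T n y"
      by blast
    then have aP: "a \<in> P"
      by (auto simp: T_def)
    have "y \<in> closure (f a)"
      unfolding closure_approachable
    proof (intro allI impI)
      fix e :: real assume "e > 0"
      then obtain n where n: "inverse (real (Suc n)) < e"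
        using reals_Archimedean by blast
      obtain z where "z \<in> f a" "dist y z \<le> inverse (real (Suc n))"
        using a[of n] by (auto simp: T_def)
      with n show "\<exists>z\<in>f a. dist z y < e"
        by (force simp: dist_commute)
    qed
    then show ?thesis
      using val(1)[OF aP] aP by auto
  qed
  then show ?thesis
    using closure_subset closure_subset_eq by blast
qed

lemma compact_metric_set_self_Tietze:
  fixes K :: "'a::metric_space set"
  assumes K: "compact K"
  shows "set_self_Tietze (top_of_set K)"
  unfolding set_self_Tietze_def
proof (intro allI impI, elim conjE)
  fix A and f :: "'a \<Rightarrow> 'a set"
  assume A: "closedin (top_of_set K) A"
    and usc0: "usc_map (subtopology (top_of_set K) A) (top_of_set K) f"
  have AK: "A \<subseteq> K"
    using A closedin_imp_subset by blast
  have cA: "compact A"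
    using A K closedin_compact by blast
  have usc: "usc_map (top_of_set A) (top_of_set K) f"
    using usc0 AK by (simp add: subtopology_subtopology Int_absorb1)
  show "\<exists>F. usc_map (top_of_set K) (top_of_set K) F \<and> (\<forall>x\<in>A. F x = f x)"
  proof (cases "A = {}")
    case True
    have "usc_map (top_of_set K) (top_of_set K) (\<lambda>_. K)"
    proof -
      have "closedin (top_of_set K) {x \<in> K. K \<inter> C \<noteq> {}}" for C
        by (cases "K \<inter> C = {}") auto
      then show ?thesis
        by (auto simp: usc_map_def closed_hyperspace_def)
    qed
    with True show ?thesis
      by blast
  next
    case False
    define P where "P x = {a \<in> A. dist x a \<le> infdist x A}" for x
    define F where "F x = (\<Union>a\<in>P x. f a)" for x
    have P_compact: "compact (P x)" for x
    proof -
      have "P x = A \<inter> cball x (infdist x A)"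
        by (auto simp: P_def)
      then show ?thesis
        using cA by (simp add: compact_Int_closed)
    qed
    \<comment> \<open>As \<open>B \<subseteq> A\<close> is compact, a point of \<open>B\<close> that is nearest to \<open>x\<close> exists, and the reverse
        inequality between the distances always holds.\<close>
    have P_meets: "P x \<inter> B \<noteq> {} \<longleftrightarrow> infdist x B \<le> infdist x A"
      if B: "compact B" "B \<subseteq> A" "B \<noteq> {}" for x B
    proof
      assume "P x \<inter> B \<noteq> {}"
      then show "infdist x B \<le> infdist x A"
        by (auto simp: P_def intro: infdist_le2)
    next
      assume le: "infdist x B \<le> infdist x A"
      have "continuous_on B (dist x)"
        by (intro continuous_intros)
      from continuous_attains_inf[OF B(1,3) this]
      obtain b where b: "b \<in> B" "\<And>b'. b' \<in> B \<Longrightarrow> dist x b \<le> dist x b'"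
        by blast
      then have "dist x b \<le> infdist x B"
        using B(3) by (auto simp: infdist_notempty intro: cINF_greatest)
      with b(1) le B(2) show "P x \<inter> B \<noteq> {}"
        by (auto simp: P_def)
    qed
    have F_closed: "closedin (top_of_set K) (F x)" for x
    proof -
      have "closed (F x)"
        unfolding F_def
        by (rule closed_UN_usc_over_compact[OF usc P_compact])
          (auto simp: P_def compact_imp_closed[OF K])
      moreover have "F x \<subseteq> K"
        using usc by (fastforce simp: F_def P_def usc_map_def closed_hyperspace_def
            dest!: closedin_imp_subset)
      ultimately show ?thesis
        by (rule closed_subset[rotated])
    qed
    have F_nonempty: "F x \<noteq> {}" for x
    proof -
      have "P x \<inter> A \<noteq> {}"
        using P_meets[OF cA order_refl False] by blast
      then obtain a where "a \<in> P x" "a \<in> A"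
        by blast
      moreover from \<open>a \<in> A\<close> have "f a \<noteq> {}"
        using usc by (auto simp: usc_map_def closed_hyperspace_def)
      ultimately show ?thesis
        unfolding F_def by blast
    qed
    have F_usc: "closedin (top_of_set K) {x \<in> K. F x \<inter> C \<noteq> {}}"
      if C: "closedin (top_of_set K) C" for C
    proof -
      define B where "B = {a \<in> A. f a \<inter> C \<noteq> {}}"
      have "closedin (top_of_set A) B"
        using usc C by (simp add: usc_map_def B_def)
      then have B: "compact B" "B \<subseteq> A"
        using cA closedin_compact closedin_imp_subset by blast+
      have eq: "F x \<inter> C \<noteq> {} \<longleftrightarrow> P x \<inter> B \<noteq> {}" for x
        by (auto simp: F_def B_def P_def)
      show ?thesis
      proof (cases "B = {}")
        case True
        then show ?thesis
          by (simp add: eq)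
      next
        case False
        have "{x \<in> K. F x \<inter> C \<noteq> {}} = K \<inter> {x. infdist x B \<le> infdist x A}"
          using P_meets[OF B False] eq by blast
        moreover have "closed {x. infdist x B \<le> infdist x A}"
          by (intro closed_Collect_le continuous_intros)
        ultimately show ?thesis
          by (simp add: closedin_closed_Int)
      qed
    qed
    have "F a = f a" if "a \<in> A" for a
    proof -
      have "P a = {a}"
        using that by (auto simp: P_def)
      then show ?thesis
        by (simp add: F_def)
    qed
    moreover have "usc_map (top_of_set K) (top_of_set K) F"
      using F_closed F_nonempty F_usc by (auto simp: usc_map_def closed_hyperspace_def)
    ultimately show ?thesis
      by blast
  qed
qed

lemma torus_eq: "torus = top_of_set (sphere 0 1 \<times> sphere 0 1)"
  by (simp add: torus_def circle_def subtopology_Times euclidean_product_topology)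

text \<open>
  The disc is embedded by \<open>z \<mapsto> (cis (Re z), cis (Im z))\<close>. Coordinates of points in the unit disc
  have absolute value at most \<open>1 \<le> pi / 2\<close>, so applying \<open>arcsin\<close> to the imaginary
  parts recovers \<open>z\<close> by a formula that is continuous on the whole torus.
\<close>

lemma torus_not_self_Tietze: "\<not> self_Tietze torus"
proof
  assume T: "self_Tietze torus"
  let ?S = "sphere (0::complex) 1"
  define e where "e z = (cis (Re z), cis (Im z))" for z
  define g where "g p = Complex (arcsin (Im (fst p))) (arcsin (Im (snd p)))"
    for p :: "complex \<times> complex"
  have e_cont: "continuous_on S e" for S
    unfolding e_def by (intro continuous_intros)
  have e_in: "e z \<in> ?S \<times> ?S" for z
    by (simp add: e_def)
  have g_e: "g (e z) = z" if "z \<in> cball 0 1" for z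
  proof -
    have "\<bar>Re z\<bar> \<le> 1" "\<bar>Im z\<bar> \<le> 1"
      using that abs_Re_le_cmod[of z] abs_Im_le_cmod[of z] by auto
    moreover have "pi / 2 > 1"
      using pi_gt3 by simp
    ultimately show ?thesis
      by (auto simp: g_def e_def complex_eq_iff intro!: arcsin_sin)
  qed
  have Im_bounds: "-1 \<le> Im w \<and> Im w \<le> 1" if "w \<in> ?S" for w
    using that abs_Im_le_cmod[of w] by auto
  have g_cont: "continuous_on (?S \<times> ?S) g"
    unfolding g_def Complex_eq
    by (intro continuous_intros continuous_on_arcsin) (use Im_bounds in auto)
  define A where "A = e ` ?S"
  have A_sub: "A \<subseteq> ?S \<times> ?S"
    unfolding A_def using e_in by blast
  have "compact A"
    unfolding A_def by (intro compact_continuous_image e_cont) simp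
  then have A_closed: "closedin torus A"
    unfolding torus_eq using A_sub by (intro closed_subset compact_imp_closed)
  have g_A: "g p \<in> ?S" if p: "p \<in> A" for p
  proof -
    obtain z where z: "z \<in> ?S" "p = e z"
      using p unfolding A_def by blast
    then have "g p = z"
      using g_e[of z] by auto
    with z show ?thesis
      by simp
  qed
  have "continuous_on A (\<lambda>p. (g p, 1::complex))"
    by (intro continuous_intros continuous_on_subset[OF g_cont] A_sub)
  then have "continuous_map (subtopology torus A) torus (\<lambda>p. (g p, 1))"
    unfolding torus_eq using A_sub g_A
    by (auto simp: subtopology_subtopology Int_absorb1)
  with T A_closed obtain F where F: "continuous_map torus torus F"
    and F_A: "\<And>p. p \<in> A \<Longrightarrow> F p = (g p, 1)"
    unfolding self_Tietze_def by meson
  have F_cont: "continuous_on (?S \<times> ?S) F" and F_in: "F ` (?S \<times> ?S) \<subseteq> ?S \<times> ?S"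
    using F unfolding torus_eq continuous_map_subtopology_eu
    by (simp_all add: image_subset_iff_funcset)
  have "retraction (cball 0 1) ?S (fst \<circ> F \<circ> e)"
    unfolding retraction_def
  proof (intro conjI ballI)
    show "continuous_on (cball 0 1) (fst \<circ> F \<circ> e)"
      unfolding comp_assoc comp_def
      by (intro continuous_intros continuous_on_compose2[OF F_cont e_cont])
        (use e_in in blast)
    have "F (e z) \<in> ?S \<times> ?S" for z
      using F_in e_in by blast
    then show "fst \<circ> F \<circ> e \<in> cball 0 1 \<rightarrow> ?S"
      by (simp add: mem_Times_iff)
    show "(fst \<circ> F \<circ> e) z = z" if "z \<in> ?S" for z
      using that F_A[of "e z"] g_e[of z] by (auto simp: A_def)
  qed auto
  then have "frontier (cball 0 1) retract_of cball (0::complex) 1"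
    by (auto simp: retract_of_def)
  then show False
    using no_retraction_cball[of 1 "0::complex"] by simp
qed

theorem proposition3p3:
  "\<not> self_Tietze torus \<and> set_self_Tietze torus"
proof
  show "set_self_Tietze torus"
    unfolding torus_eq by (intro compact_metric_set_self_Tietze compact_Times compact_sphere)
qed (rule torus_not_self_Tietze)

end
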